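(* Let $0<a<1$ and $b<1$ be real and let $N\in\mathbb{Z}_{>0}$. For all $n,x\in\{0,1,\ldots,N\}$ the limit $$Q_n^{a,b,N;0}(x):=\lim_{q\downarrow0}\,Q_n^{a,b,N;q}(x)$$ exists, and it equals the little $0$-Jacobi function $p_n^{a,b;0}$ restricted to $\{0,1,\ldots,N\}$: $$Q_n^{a,b,N;0}(x)=p_n^{a,b;0}(x)\qquad(n,x=0,1,\ldots,N).$$
   Context: For $0<q<1$ and $k\in\mathbb{Z}_{\ge0}$ write $(c;q)_k:=\prod_{i=0}^{k-1}(1-cq^i)$. The (reparametrized) $q$-Hahn polynomials are, for $N\in\mathbb{Z}_{>0}$ and $n,x\in\{0,1,\ldots,N\}$, $$Q_n^{a,b,N;q}(x):={}_3\phi_2\left(q^{-n},abq^{n-1},q^{x-N};a,q^{-N};q,q\right)=\sum_{k=0}^n\frac{(q^{-n};q)_k\,(abq^{n-1};q)_k\,(q^{x-N};q)_k}{(a;q)_k\,(q^{-N};q)_k\,(q;q)_k}\,q^k.$$ The little $0$-Jacobi functions $p_n^{a,b;0}:\mathbb{Z}_{\ge0}\to\mathbb{R}$ ($n\in\mathbb{Z}_{\ge0}$) are given by: $p_0^{a,b;0}(x)=1$ for all $x$; $p_1^{a,b;0}(0)=-\frac{a(1-b)}{1-a}$ and $p_1^{a,b;0}(x)=1$ for $x>0$; and for $n\ge2$, $p_n^{a,b;0}(x)=0$ if $0\le x<n-1$, $p_n^{a,b;0}(n-1)=-\frac{a}{1-a}$, and $p_n^{a,b;0}(x)=1$ if $x>n-1$.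 *)

theory Defs
  imports "HOL-Analysis.Analysis"
begin

definition qpoch :: "real \<Rightarrow> real \<Rightarrow> nat \<Rightarrow> real" where
  "qpoch c q k = (\<Prod>i<k. 1 - c * q ^ i)"

text \<open>
  The terminating series \<open>\<^sub>3\<phi>\<^sub>2(q\<^sup>-\<^sup>n, a b q\<^sup>n\<^sup>-\<^sup>1, q\<^sup>x\<^sup>-\<^sup>N; a, q\<^sup>-\<^sup>N; q, q)\<close>, summed up to \<open>k = n\<close>;
  meant for \<open>0 < q < 1\<close> and \<open>n, x \<le> N\<close>, so that \<open>(q\<^sup>-\<^sup>N; q)\<^sub>k\<close> does not vanish in the sum.
  The exponents are integers: \<open>n - 1\<close> is \<open>-1\<close> for \<open>n = 0\<close>.
\<close>

definition q_Hahn :: "real \<Rightarrow> real \<Rightarrow> nat \<Rightarrow> real \<Rightarrow> nat \<Rightarrow> nat \<Rightarrow> real" where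
  "q_Hahn a b N q n x =
     (\<Sum>k\<le>n. (qpoch (q powi (- int n)) q k * qpoch (a * b * q powi (int n - 1)) q k
               * qpoch (q powi (int x - int N)) q k)
            / (qpoch a q k * qpoch (q powi (- int N)) q k * qpoch q q k) * q ^ k)"

definition little_0_Jacobi :: "real \<Rightarrow> real \<Rightarrow> nat \<Rightarrow> nat \<Rightarrow> real" where
  "little_0_Jacobi a b n x =
     (if n = 0 then 1
      else if n = 1 then (if x = 0 then - (a * (1 - b) / (1 - a)) else 1)
      else if x < n - 1 then 0
      else if x = n - 1 then - (a / (1 - a))
      else 1)"

end

theory Submission
  imports Defs
begin

text \<open>
  Pulling the negative powers of \<open>q\<close> out of the Pochhammer symbols gives
  \<open>Q\<^sub>n(x) = \<Sum>\<^sub>k (-1)\<^sup>k q\<^bsup>k(k-1)/2 + k(x-n+1)\<^esup> [n,k] [N-x,k]/[N,k] (abq\<^bsup>n-1\<^esup>)\<^sub>k/(a)\<^sub>k\<close>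
  with Gaussian binomials \<open>[n,k]\<close>.  For \<open>x \<ge> n - 1\<close> no exponent is negative and only \<open>k \<le> 1\<close>
  can contribute to the limit.  For \<open>x < n - 1\<close> the terms blow up and cancel.  To exhibit the
  cancellation, expand \<open>[N-x,k]/[N,k]\<close> in powers \<open>q\<^bsup>-ki\<^esup>\<close>, \<open>i \<le> x\<close>, by the \<open>q\<close>-binomial
  theorem, and \<open>(abq\<^bsup>n-1\<^esup>)\<^sub>k/(a)\<^sub>k\<close> in \<open>[k,j]\<close>, \<open>j \<le> n\<close>, by the \<open>q\<close>-Chu-Vandermonde formula.
  The sum over \<open>k\<close> is then a multiple of \<open>(q\<^sup>p; q)\<^bsub>n-j\<^esub>\<close> with \<open>p = j + x - i - n + 1\<close>.  It vanishes
  for \<open>p \<le> 0\<close>, while for \<open>p > 0\<close>, which forces \<open>j \<ge> 2\<close>, a positive power of \<open>q\<close> is left over.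
\<close>

section \<open>Pochhammer symbols and Gaussian binomials\<close>

text \<open>The product form stays meaningful at q = 0, where the limits are taken, and makes the
  value 0 for k > n automatic: the factor with i = n contains \<open>1 - q ^ 0\<close>.\<close>

definition qbinom :: "real \<Rightarrow> nat \<Rightarrow> nat \<Rightarrow> real" where
  "qbinom q n k = (\<Prod>i<k. (1 - q ^ (n - i)) / (1 - q ^ Suc i))"

lemma qpoch_0 [simp]: "qpoch c q 0 = 1"
  by (simp add: qpoch_def)

lemma qpoch_Suc: "qpoch c q (Suc k) = qpoch c q k * (1 - c * q ^ k)"
  by (simp add: qpoch_def)

lemma qpoch_Suc_left: "qpoch c q (Suc k) = (1 - c) * qpoch (c * q) q k"
  by (simp add: qpoch_def prod.lessThan_Suc_shift mult.assoc del: prod.lessThan_Suc)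

lemma qpoch_eq_0:
  assumes "c * q ^ i = 1" "i < k"
  shows "qpoch c q k = 0"
  using assms unfolding qpoch_def by (intro prod_zero) auto

lemma qpoch_nonzero:
  assumes "0 < q" "q < 1" "0 < c" "c < 1"
  shows "qpoch c q k \<noteq> 0"
proof -
  have "c * q ^ i < 1" for i
  proof -
    have "c * q ^ i \<le> c * 1"
      using assms by (intro mult_left_mono power_le_one) auto
    then show ?thesis using assms(4) by linarith
  qed
  then show ?thesis unfolding qpoch_def by (auto simp: less_le)
qed

lemma qbinom_0 [simp]: "qbinom q n 0 = 1"
  by (simp add: qbinom_def)

lemma qbinom_Suc:
  "qbinom q n (Suc k) = qbinom q n k * ((1 - q ^ (n - k)) / (1 - q ^ Suc k))"
  by (simp add: qbinom_def)

lemma qbinom_eq_0: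
  assumes "n < k"
  shows "qbinom q n k = 0"
  using assms unfolding qbinom_def by (intro prod_zero) (auto intro!: bexI[of _ n])

lemma zero_choose_two [simp]: "0 choose 2 = 0"
  by (simp add: numeral_2_eq_2)

lemma Suc_choose_two: "Suc k choose 2 = (k choose 2) + k"
  by (simp add: numeral_2_eq_2)

context
  fixes q :: real
  assumes q0: "0 < q" and q1: "q < 1"
begin

lemma one_minus_power_nonzero: "1 - q ^ Suc i \<noteq> 0"
  using q0 q1 power_Suc_less_one[of q i] by simp

lemma qpoch_qpowi_eq_0:
  assumes "p \<le> 0" "- p < int k"
  shows "qpoch (q powi p) q k = 0"
proof (rule qpoch_eq_0)
  have "q powi p * q ^ nat (- p) = q powi (p + int (nat (- p)))"
    using q0 power_int_add[of q p "int (nat (- p))"] by (simp only: power_int_of_nat) auto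
  then show "q powi p * q ^ nat (- p) = 1" using assms by simp
  show "nat (- p) < k" using assms by linarith
qed

text \<open>Passing from k to k+1 only moves factors: \<open>1 - q ^ (n - k)\<close> leaves
  (q;q)_(n-k) and enters the Gaussian binomial, whose new denominator is the new factor of
  (q;q)_k.\<close>

lemma qbinom_fact:
  assumes "k \<le> n"
  shows "qbinom q n k * (qpoch q q k * qpoch q q (n - k)) = qpoch q q n"
  using assms
proof (induction k)
  case 0
  then show ?case by simp
next
  case (Suc k)
  then obtain m where m: "n - k = Suc m" "n - Suc k = m"
    by (metis Suc_diff_Suc Suc_le_lessD)
  have "qbinom q n (Suc k) * (qpoch q q (Suc k) * qpoch q q m)
      = qbinom q n k * (qpoch q q k * qpoch q q (Suc m))"
    unfolding qbinom_Suc qpoch_Suc m power_Suc[symmetric]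
    using one_minus_power_nonzero[of k] by (simp only: times_divide_eq_right) simp
  then show ?case
    using Suc m by simp
qed

lemma qpoch_qq_nonzero: "qpoch q q k \<noteq> 0"
  using qpoch_nonzero q0 q1 by blast

lemma qbinom_nonzero:
  assumes "k \<le> n"
  shows "qbinom q n k \<noteq> 0"
  using qbinom_fact[OF assms] qpoch_qq_nonzero[of n] by auto

lemma qbinom_Suc_Suc:
  "qbinom q (Suc n) (Suc k) = (1 - q ^ Suc n) / (1 - q ^ Suc k) * qbinom q n k"
proof -
  have "qbinom q n k = (\<Prod>i<k. 1 - q ^ (n - i)) / (\<Prod>i<k. 1 - q ^ Suc i)" for n k
    by (simp add: qbinom_def prod_dividef)
  moreover have "(\<Prod>i<Suc k. 1 - q ^ (Suc n - i)) = (1 - q ^ Suc n) * (\<Prod>i<k. 1 - q ^ (n - i))"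
    by (simp add: prod.lessThan_Suc_shift del: prod.lessThan_Suc)
  ultimately show ?thesis by simp
qed

text \<open>All three terms are multiples of [n,k]. With u = q^(n-k) and v = q^(k+1) what remains is
  1 - uv = (1 - u) + u(1 - v).\<close>

lemma qbinom_pascal:
  "qbinom q (Suc n) (Suc k) = qbinom q n (Suc k) + q ^ (n - k) * qbinom q n k"
proof (cases "k \<le> n")
  case True
  then have n: "q ^ Suc n = q ^ (n - k) * q ^ Suc k"
    by (simp flip: power_add)
  have "(1 - u * v) / (1 - v) * w = w * ((1 - u) / (1 - v)) + u * w" if "1 - v \<noteq> 0" for u v w :: real
    using that by (simp add: field_simps)
  then show ?thesis
    unfolding qbinom_Suc_Suc qbinom_Suc[of q n k] n
    using one_minus_power_nonzero[of k] by blast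
next
  case False
  then show ?thesis by (simp add: qbinom_eq_0)
qed

text \<open>Both sides equal (q;q)_n / ((q;q)_j (q;q)_(k-j) (q;q)_(n-k)).\<close>

lemma qbinom_trinomial:
  assumes "j \<le> k" "k \<le> n"
  shows "qbinom q n k * qbinom q k j = qbinom q n j * qbinom q (n - j) (k - j)"
proof -
  have f: "qbinom q n k = qpoch q q n / (qpoch q q k * qpoch q q (n - k))" if "k \<le> n" for n k
    using qbinom_fact[OF that] qpoch_qq_nonzero by (simp add: field_simps)
  have "n - j - (k - j) = n - k" using assms by simp
  then show ?thesis
    using assms qpoch_qq_nonzero by (simp add: f)
qed

section \<open>The q-binomial theorem and the q-Chu-Vandermonde formula\<close>

text \<open>Pascal's rule turns the sum S for n+1 into S - z q^n S with S the sum for n, which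
  matches the new factor 1 - z q^n.\<close>

lemma q_binomial_theorem:
  "qpoch z q n = (\<Sum>k\<le>n. (-1) ^ k * q ^ (k choose 2) * qbinom q n k * z ^ k)"
proof (induction n)
  case 0
  then show ?case by simp
next
  case (Suc n)
  define t where "t n k = (-1) ^ k * q ^ (k choose 2) * qbinom q n k * z ^ k" for n k
  have step: "t (Suc n) (Suc k) = t n (Suc k) - z * q ^ n * t n k" if "k \<le> n" for k
  proof -
    have "q ^ n = q ^ k * q ^ (n - k)" using that by (simp flip: power_add)
    then show ?thesis
      by (simp add: t_def qbinom_pascal Suc_choose_two power_add algebra_simps)
  qed
  have "(\<Sum>k\<le>Suc n. t (Suc n) k) = t (Suc n) 0 + (\<Sum>k\<le>n. t (Suc n) (Suc k))"
    by (rule sum.atMost_Suc_shift)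
  also have "\<dots> = t n 0 + (\<Sum>k\<le>n. t n (Suc k)) - z * q ^ n * (\<Sum>k\<le>n. t n k)"
    by (simp add: step sum_subtractf sum_distrib_left) (simp add: t_def)
  also have "t n 0 + (\<Sum>k\<le>n. t n (Suc k)) = (\<Sum>k\<le>Suc n. t n k)"
    by (rule sum.atMost_Suc_shift [symmetric])
  also have "\<dots> = (\<Sum>k\<le>n. t n k)"
    by (simp add: t_def qbinom_eq_0)
  finally show ?case
    using Suc.IH by (simp add: t_def qpoch_Suc algebra_simps)
qed

text \<open>
  The terminating sum \<open>\<^sub>2\<phi>\<^sub>1(q\<^sup>-\<^sup>k, a/c; a; q, c q\<^sup>k)\<close>, with the factors \<open>1 - (a/c) q\<^sup>l\<close> multiplied by
  \<open>c\<close> so that \<open>c = 0\<close> is allowed.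
\<close>

lemma q_Chu_Vandermonde:
  assumes "0 < a" "a < 1"
  shows "qpoch c q k / qpoch a q k =
    (\<Sum>j\<le>k. (-1) ^ j * q ^ (j choose 2) * qbinom q k j * (\<Prod>l<j. c - a * q ^ l) / qpoch a q j)"
  using assms
\<comment> \<open>Splitting by Pascal's rule leaves a second sum in which the first factors of the
  product and of (a;q)_(j+1) are peeled off. This replaces a by aq, so a has to vary.\<close>
proof (induction k arbitrary: a)
  case 0
  then show ?case by simp
next
  case (Suc k)
  define t where "t a k j =
    (-1) ^ j * q ^ (j choose 2) * qbinom q k j * (\<Prod>l<j. c - a * q ^ l) / qpoch a q j" for a k j
  have aq: "0 < a * q" "a * q < 1"
    using Suc.prems q0 q1 by (auto intro: less_trans[OF mult_strict_left_mono[of q 1 a]])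
  have step: "t a (Suc k) (Suc j) = t a k (Suc j) - q ^ k * (c - a) / (1 - a) * t (a * q) k j"
    if "j \<le> k" for j
  proof -
    have "q ^ k = q ^ j * q ^ (k - j)" using that by (simp flip: power_add)
    moreover have "(\<Prod>l<Suc j. c - a * q ^ l) = (c - a) * (\<Prod>l<j. c - a * q * q ^ l)"
      by (simp add: prod.lessThan_Suc_shift mult.assoc del: prod.lessThan_Suc)
    moreover have "t a (Suc k) (Suc j) = t a k (Suc j) +
       (-1) ^ Suc j * q ^ (Suc j choose 2) * (q ^ (k - j) * qbinom q k j)
         * (\<Prod>l<Suc j. c - a * q ^ l) / qpoch a q (Suc j)"
      unfolding t_def qbinom_pascal by (simp only: distrib_left distrib_right add_divide_distrib)
    ultimately show ?thesis
      by (simp add: t_def qpoch_Suc_left Suc_choose_two power_add mult_ac)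
  qed
  have "(\<Sum>j\<le>Suc k. t a (Suc k) j) = t a (Suc k) 0 + (\<Sum>j\<le>k. t a (Suc k) (Suc j))"
    by (rule sum.atMost_Suc_shift)
  also have "\<dots> = t a k 0 + (\<Sum>j\<le>k. t a k (Suc j))
      - q ^ k * (c - a) / (1 - a) * (\<Sum>j\<le>k. t (a * q) k j)"
    by (simp add: step sum_subtractf sum_distrib_left) (simp add: t_def)
  also have "t a k 0 + (\<Sum>j\<le>k. t a k (Suc j)) = (\<Sum>j\<le>Suc k. t a k j)"
    by (rule sum.atMost_Suc_shift [symmetric])
  also have "\<dots> = (\<Sum>j\<le>k. t a k j)"
    by (simp add: t_def qbinom_eq_0)
  also have "\<dots> = qpoch c q k / qpoch a q k"
    using Suc.IH[OF Suc.prems] by (simp add: t_def)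
  also have "(\<Sum>j\<le>k. t (a * q) k j) = qpoch c q k / qpoch (a * q) q k"
    using Suc.IH[OF aq] by (simp add: t_def)
  \<comment> \<open>Over the common denominator (a;q)_(k+1) this is (1 - a q^k) - q^k (c - a) = 1 -
    c q^k.\<close>
  also have "qpoch c q k / qpoch a q k - q ^ k * (c - a) / (1 - a) * (qpoch c q k / qpoch (a * q) q k)
      = qpoch c q (Suc k) / qpoch a q (Suc k)"
  proof -
    have A: "qpoch a q k \<noteq> 0" "qpoch a q (Suc k) \<noteq> 0"
      using qpoch_nonzero q0 q1 Suc.prems by blast+
    have "1 - a * q ^ k \<noteq> 0" using A(2) by (simp add: qpoch_Suc)
    then have 1: "qpoch c q k / qpoch a q k = qpoch c q k * (1 - a * q ^ k) / qpoch a q (Suc k)"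
      by (simp add: qpoch_Suc)
    have 2: "q ^ k * (c - a) / (1 - a) * (qpoch c q k / qpoch (a * q) q k)
        = q ^ k * (c - a) * qpoch c q k / qpoch a q (Suc k)"
      by (simp add: qpoch_Suc_left)
    show ?thesis
      unfolding 1 2 qpoch_Suc[of c] diff_divide_distrib[symmetric] by (simp add: algebra_simps)
  qed
  finally show ?case by (simp add: t_def)
qed

section \<open>The q-Hahn polynomial in terms of Gaussian binomials\<close>

text \<open>Each factor is 1 - q^(i-n) = -q^(i-n) (1 - q^(n-i)), and the powers q^(i-n) are
  collected. For k > n both sides vanish.\<close>

lemma qpoch_inverse_power:
  "qpoch (q powi (- int n)) q k =
     (-1) ^ k * q ^ (k choose 2) * q powi (- int (n * k)) * qpoch q q k * qbinom q n k"
proof (cases "k \<le> n")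
  case True
  then show ?thesis
  proof (induction k)
    case 0
    then show ?case by simp
  next
    case (Suc k)
    have "q powi (- int n) * q ^ k = q powi (int k - int n)"
      using q0 by (simp add: power_int_diff power_int_minus field_simps)
    moreover have "q powi (int k - int n) * q ^ (n - k) = 1"
      using q0 Suc.prems by (simp add: power_int_diff field_simps flip: power_add)
    ultimately have "1 - q powi (- int n) * q ^ k = - (q powi (- int n) * q ^ k * (1 - q ^ (n - k)))"
      by (simp add: algebra_simps)
    moreover have "q powi (- int (n * Suc k)) = q powi (- int (n * k)) * q powi (- int n)"
      using q0 by (simp flip: power_int_add add: algebra_simps)
    moreover have "qpoch q q (Suc k) * qbinom q n (Suc k)
        = qpoch q q k * qbinom q n k * (1 - q ^ (n - k))"
      using one_minus_power_nonzero[of k] by (simp add: qpoch_Suc qbinom_Suc)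
    ultimately show ?case
      using Suc by (simp add: qpoch_Suc[of "q powi (- int n)"] Suc_choose_two power_add mult_ac)
  qed
next
  case False
  then show ?thesis
    using qpoch_qpowi_eq_0[of "- int n" k] by (simp add: qbinom_eq_0)
qed

text \<open>Three symbols have a negative power of q as base. After rewriting them, all (q;q)_k
  cancel, one sign and one q^(k choose 2) survive, and the other exponents add up to -nk - (N-x)k +
  Nk + k.\<close>

lemma q_Hahn_eq:
  assumes "n \<le> N" "x \<le> N"
  shows "q_Hahn a b N q n x =
    (\<Sum>k\<le>n. (-1) ^ k * q ^ (k choose 2) * q powi (int k * (int x - int n + 1)) * qbinom q n k
       * (qbinom q (N - x) k / qbinom q N k)
       * (qpoch (a * b * q powi (int n - 1)) q k / qpoch a q k))"
  unfolding q_Hahn_def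
proof (rule sum.cong [OF refl])
  fix k assume "k \<in> {..n}"
  then have k: "k \<le> N" using assms by simp
  define c where "c = qpoch (a * b * q powi (int n - 1)) q k"
  have xN: "int x - int N = - int (N - x)" using assms by simp
  have pw: "q powi (int k * (int x - int n + 1)) =
      q powi (- int (n * k)) * q powi (- int ((N - x) * k)) / q powi (- int (N * k)) * q ^ k"
  proof -
    have "int k * (int x - int n + 1) = - int (n * k) + - int ((N - x) * k) - (- int (N * k)) + int k"
      using assms by (simp add: algebra_simps of_nat_diff)
    moreover have "q powi (u + v - w + int k) = q powi u * q powi v / q powi w * q ^ k" for u v w
      using q0 by (simp add: power_int_add power_int_diff)
    ultimately show ?thesis by metis
  qed
  have nz: "q powi (- int (N * k)) \<noteq> 0" "qpoch q q k \<noteq> 0" "qbinom q N k \<noteq> 0" "q ^ (k choose 2) \<noteq> 0"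
    using q0 qpoch_qq_nonzero qbinom_nonzero[OF k] by auto
  show "qpoch (q powi (- int n)) q k * qpoch (a * b * q powi (int n - 1)) q k
        * qpoch (q powi (int x - int N)) q k
      / (qpoch a q k * qpoch (q powi (- int N)) q k * qpoch q q k) * q ^ k
    = (-1) ^ k * q ^ (k choose 2) * q powi (int k * (int x - int n + 1)) * qbinom q n k
       * (qbinom q (N - x) k / qbinom q N k)
       * (qpoch (a * b * q powi (int n - 1)) q k / qpoch a q k)"
    unfolding xN qpoch_inverse_power pw c_def[symmetric]
    using nz by (simp add: divide_simps)
qed

section \<open>The double sum left after summation over \<open>k\<close>\<close>

text \<open>The point is that the quotient is a polynomial of degree x in q^(-k), ready for the
  q-binomial theorem. It arises from (q;q)_(N-k) / (q;q)_(N-x-k); for k > N - x the Pochhammer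
  symbol on the right contains the factor 1 - q^0.\<close>

lemma qbinom_quotient:
  assumes "k \<le> N" "x \<le> N"
  shows "qbinom q (N - x) k / qbinom q N k =
    qpoch q q (N - x) / qpoch q q N * qpoch (q powi (int (N - x) - int k + 1)) q x"
proof (cases "k \<le> N - x")
  case True
  have "qpoch q q (m + x) = qpoch q q m * qpoch (q ^ Suc m) q x" for m
    by (induction x) (simp_all add: qpoch_Suc mult_ac power_add)
  from this[of "N - x - k"] have "qpoch q q (N - k)
      = qpoch q q (N - x - k) * qpoch (q ^ Suc (N - x - k)) q x"
    using True assms by simp
  moreover have "q powi (int (N - x) - int k + 1) = q ^ Suc (N - x - k)"
  proof -
    have "int (N - x) - int k + 1 = int (Suc (N - x - k))"
      using True by simp
    then show ?thesis by (simp only: power_int_of_nat)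
  qed
  moreover have "qbinom q (N - x) k =
      qpoch q q (N - x) / (qpoch q q k * qpoch q q (N - x - k))"
    using qbinom_fact[OF True] qpoch_qq_nonzero by (simp add: field_simps)
  moreover have "qbinom q N k = qpoch q q N / (qpoch q q k * qpoch q q (N - k))"
    using qbinom_fact[OF assms(1)] qpoch_qq_nonzero by (simp add: field_simps)
  moreover have "A / (B * C) / (D / (B * (C * E))) = A / D * E"
    if "B \<noteq> 0" "C \<noteq> 0" for A B C D E :: real
    using that by simp
  ultimately show ?thesis
    using qpoch_qq_nonzero by (simp only:) simp
next
  case False
  then show ?thesis
    using assms by (subst qpoch_qpowi_eq_0) (auto simp: qbinom_eq_0)
qed

text \<open>Trinomial revision pulls out [n,j]. With k = j + l, the cross term jl in (j+l choose 2)
  turns the rest into the q-binomial theorem at z = q^(j+m).\<close>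

lemma qbinom_product_sum:
  assumes "j \<le> n"
  shows "(\<Sum>k\<le>n. (-1) ^ k * q ^ (k choose 2) * qbinom q n k * qbinom q k j * q powi (int k * m)) =
    (-1) ^ j * q ^ (j choose 2) * q powi (int j * m) * qbinom q n j
      * qpoch (q powi (int j + m)) q (n - j)"
proof -
  define f where
    "f k = (-1) ^ k * q ^ (k choose 2) * qbinom q n k * qbinom q k j * q powi (int k * m)" for k
  have "(\<Sum>k\<le>n. f k) = (\<Sum>k\<in>{j..n}. f k)"
    by (rule sum.mono_neutral_right) (auto simp: f_def qbinom_eq_0)
  also have "\<dots> = (\<Sum>l\<le>n - j. f (j + l))"
    by (rule sum.reindex_bij_witness[of _ "\<lambda>l. j + l" "\<lambda>k. k - j"]) (use assms in auto)
  also have "\<dots> = (\<Sum>l\<le>n - j. ((-1) ^ j * q ^ (j choose 2) * q powi (int j * m) * qbinom q n j)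
      * ((-1) ^ l * q ^ (l choose 2) * qbinom q (n - j) l * (q powi (int j + m)) ^ l))"
  proof (rule sum.cong [OF refl])
    fix l assume "l \<in> {..n - j}"
    then have tri: "qbinom q n (j + l) * qbinom q (j + l) j = qbinom q n j * qbinom q (n - j) l"
      using qbinom_trinomial[of j "j + l" n] assms by simp
    have ch: "(j + l) choose 2 = (j choose 2) + (l choose 2) + j * l"
      by (induction l) (simp_all add: Suc_choose_two)
    have pw: "q powi (int (j + l) * m) * q ^ (j * l) = q powi (int j * m) * (q powi (int j + m)) ^ l"
    proof -
      have "q powi (int (j + l) * m) * q ^ (j * l) = q powi (int (j + l) * m + int (j * l))"
        using q0 power_int_add[of q "int (j + l) * m" "int (j * l)"]
        by (simp only: power_int_of_nat) auto
      also have "int (j + l) * m + int (j * l) = int j * m + (int j + m) * int l"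
        by (simp add: algebra_simps)
      also have "q powi \<dots> = q powi (int j * m) * (q powi (int j + m)) ^ l"
        using q0 by (subst power_int_add) (auto simp: power_int_mult)
      finally show ?thesis .
    qed
    have "f (j + l) = (-1) ^ j * (-1) ^ l * (q ^ (j choose 2) * q ^ (l choose 2))
        * (qbinom q n (j + l) * qbinom q (j + l) j) * (q powi (int (j + l) * m) * q ^ (j * l))"
      unfolding f_def ch power_add by (simp only: mult_ac)
    then show "f (j + l) = ((-1) ^ j * q ^ (j choose 2) * q powi (int j * m) * qbinom q n j)
      * ((-1) ^ l * q ^ (l choose 2) * qbinom q (n - j) l * (q powi (int j + m)) ^ l)"
      unfolding tri pw by (simp only: mult_ac)
  qed
  also have "\<dots> = ((-1) ^ j * q ^ (j choose 2) * q powi (int j * m) * qbinom q n j)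
      * qpoch (q powi (int j + m)) q (n - j)"
    by (simp add: q_binomial_theorem sum_distrib_left)
  finally show ?thesis by (simp add: f_def)
qed

text \<open>The three groups of factors come from expanding [N-x,k]/[N,k], from q-Chu-Vandermonde,
  and from the sum over k, which \<open>qbinom_product_sum\<close> evaluates with m = x - n + 1 -
  i.\<close>

lemma q_Hahn_double_sum:
  fixes a b :: real
  assumes a: "0 < a" "a < 1" and "n \<le> N" "x \<le> N"
  defines "c \<equiv> a * b * q powi (int n - 1)"
  shows "q_Hahn a b N q n x = qpoch q q (N - x) / qpoch q q N *
    (\<Sum>i\<le>x. \<Sum>j\<le>n.
       ((-1) ^ i * q ^ (i choose 2) * qbinom q x i * q ^ (Suc (N - x) * i)) *
       ((-1) ^ j * q ^ (j choose 2) * (\<Prod>l<j. c - a * q ^ l) / qpoch a q j) *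
       ((-1) ^ j * q ^ (j choose 2) * q powi (int j * (int x - int n + 1 - int i)) * qbinom q n j
        * qpoch (q powi (int j + (int x - int n + 1 - int i))) q (n - j)))"
proof -
  define P where "P = qpoch q q (N - x) / qpoch q q N"
  define A where "A i = (-1) ^ i * q ^ (i choose 2) * qbinom q x i * q ^ (Suc (N - x) * i)" for i
  define B where "B j = (-1) ^ j * q ^ (j choose 2) * (\<Prod>l<j. c - a * q ^ l) / qpoch a q j" for j
  define C where "C k = (-1) ^ k * q ^ (k choose 2) * qbinom q n k" for k
  have 1: "q powi (int k * (int x - int n + 1)) * (qbinom q (N - x) k / qbinom q N k) =
      P * (\<Sum>i\<le>x. A i * q powi (int k * (int x - int n + 1 - int i)))" if "k \<le> n" for k
  proof -
    have e: "q powi (int k * (int x - int n + 1)) * (q powi (int (N - x) - int k + 1)) ^ i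
       = q ^ (Suc (N - x) * i) * q powi (int k * (int x - int n + 1 - int i))" for i
    proof -
      have "(q powi (int (N - x) - int k + 1)) ^ i = q powi ((int (N - x) - int k + 1) * int i)"
        by (simp add: power_int_mult)
      moreover have "q ^ (Suc (N - x) * i) = q powi int (Suc (N - x) * i)"
        by (rule power_int_of_nat [symmetric])
      moreover have "int k * (int x - int n + 1) + (int (N - x) - int k + 1) * int i
          = int (Suc (N - x) * i) + int k * (int x - int n + 1 - int i)"
        unfolding of_nat_mult of_nat_Suc by (simp add: algebra_simps)
      ultimately show ?thesis
        using q0 by (metis less_irrefl power_int_add)
    qed
    have "qbinom q (N - x) k / qbinom q N k = P * qpoch (q powi (int (N - x) - int k + 1)) q x"
      unfolding P_def using that assms by (intro qbinom_quotient) auto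
    then show ?thesis
      unfolding q_binomial_theorem[of _ x] A_def
      by (simp add: sum_distrib_left mult_ac)
         (intro sum.cong refl, use e in \<open>simp add: mult_ac\<close>)
  qed
  have 2: "qpoch c q k / qpoch a q k = (\<Sum>j\<le>n. B j * qbinom q k j)" if "k \<le> n" for k
  proof -
    have "qpoch c q k / qpoch a q k = (\<Sum>j\<le>k. B j * qbinom q k j)"
      unfolding q_Chu_Vandermonde[OF a] B_def by (simp add: mult_ac)
    \<comment> \<open>Since [k,j] = 0 for j > k, the range of j can be made independent of k, so
      that the sums can be interchanged.\<close>
    also have "\<dots> = (\<Sum>j\<le>n. B j * qbinom q k j)"
      by (rule sum.mono_neutral_left) (use that in \<open>auto simp: qbinom_eq_0\<close>)
    finally show ?thesis .
  qed
  have "q_Hahn a b N q n x = (\<Sum>k\<le>n. C k *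
      (q powi (int k * (int x - int n + 1)) * (qbinom q (N - x) k / qbinom q N k)) *
      (qpoch c q k / qpoch a q k))"
    unfolding q_Hahn_eq[OF assms(3,4)] C_def c_def by (simp add: mult_ac)
  also have "\<dots> = (\<Sum>k\<le>n. C k * (P * (\<Sum>i\<le>x. A i * q powi (int k * (int x - int n + 1 - int i))))
      * (\<Sum>j\<le>n. B j * qbinom q k j))"
    by (intro sum.cong refl) (simp only: 1 2 atMost_iff)
  also have "\<dots> = P * (\<Sum>k\<le>n. \<Sum>i\<le>x. \<Sum>j\<le>n. A i * B j *
      (C k * qbinom q k j * q powi (int k * (int x - int n + 1 - int i))))"
    by (simp add: sum_distrib_left sum_distrib_right mult_ac sum_product)
  also have "(\<Sum>k\<le>n. \<Sum>i\<le>x. \<Sum>j\<le>n. A i * B j *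
      (C k * qbinom q k j * q powi (int k * (int x - int n + 1 - int i))))
    = (\<Sum>i\<le>x. \<Sum>k\<le>n. \<Sum>j\<le>n. A i * B j *
      (C k * qbinom q k j * q powi (int k * (int x - int n + 1 - int i))))"
    by (rule sum.swap)
  also have "\<dots> = (\<Sum>i\<le>x. \<Sum>j\<le>n. \<Sum>k\<le>n. A i * B j *
      (C k * qbinom q k j * q powi (int k * (int x - int n + 1 - int i))))"
    by (intro sum.cong refl sum.swap)
  also have "\<dots> = (\<Sum>i\<le>x. \<Sum>j\<le>n. A i * B j *
     ((-1) ^ j * q ^ (j choose 2) * q powi (int j * (int x - int n + 1 - int i)) * qbinom q n j
        * qpoch (q powi (int j + (int x - int n + 1 - int i))) q (n - j)))"
    by (intro sum.cong refl, subst qbinom_product_sum[symmetric])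
       (auto simp: C_def sum_distrib_left)
  finally show ?thesis unfolding P_def A_def B_def .
qed

lemma prod_power_lessThan: "(\<Prod>l<j. q ^ l) = q ^ (j choose 2)"
  by (induction j) (simp_all add: Suc_choose_two power_add)

text \<open>For p > 0 no negative power of q is left. Taking q^l out of each factor of the product
  gives a third q^(j choose 2), and 2 (j choose 2) = j^2 - j yields 3 (j choose 2) + j(p - j) = (j
  choose 2) + j(p - 1).\<close>

lemma double_sum_term:
  fixes a b :: real
  assumes "j \<le> n" "0 < p" "int p = int j + (int x - int n + 1 - int i)"
  shows "((-1) ^ j * q ^ (j choose 2) * (\<Prod>l<j. a * b * q powi (int n - 1) - a * q ^ l) / qpoch a q j) *
       ((-1) ^ j * q ^ (j choose 2) * q powi (int j * (int x - int n + 1 - int i)) * qbinom q n j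
        * qpoch (q powi (int j + (int x - int n + 1 - int i))) q (n - j))
   = q ^ ((j choose 2) + j * (p - 1)) * ((\<Prod>l<j. a * b * q ^ (n - 1 - l) - a) / qpoch a q j
        * qbinom q n j * qpoch (q ^ p) q (n - j))"
proof -
  define T where "T = (\<Prod>l<j. a * b * q ^ (n - 1 - l) - a)"
  have "a * b * q powi (int n - 1) - a * q ^ l = q ^ l * (a * b * q ^ (n - 1 - l) - a)" if "l < j" for l
  proof -
    have "q powi (int n - 1) = q ^ (n - 1)"
      using that assms(1) by (simp add: power_int_def nat_diff_distrib)
    also have "\<dots> = q ^ l * q ^ (n - 1 - l)"
      using that assms(1) by (simp flip: power_add)
    finally show ?thesis by (simp add: algebra_simps)
  qed
  then have T: "(\<Prod>l<j. a * b * q powi (int n - 1) - a * q ^ l) = q ^ (j choose 2) * T"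
    by (simp add: T_def prod.distrib flip: prod_power_lessThan)
  have "2 * (j choose 2) + j = j * j"
    by (induction j) (simp_all add: Suc_choose_two)
  then have "int j * int j = 2 * int (j choose 2) + int j"
    by (metis of_nat_add of_nat_mult of_nat_numeral)
  moreover have "int j * (int x - int n + 1 - int i) = int j * (int p - int j)"
    using assms(3) by (intro arg_cong2[where f = times] refl) linarith
  ultimately have "int (j choose 2) + int (j choose 2) + int (j choose 2)
      + int j * (int x - int n + 1 - int i) = int ((j choose 2) + j * (p - 1))"
    using assms by (cases p) (auto simp: algebra_simps)
  then have pw: "q ^ (j choose 2) * q ^ (j choose 2) * q ^ (j choose 2)
      * q powi (int j * (int x - int n + 1 - int i)) = q ^ ((j choose 2) + j * (p - 1))"
    using q0 by (metis less_irrefl power_int_add power_int_of_nat)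
  have sg: "(-1 :: real) ^ j * (-1) ^ j = 1" by (simp flip: power_add)
  have "((-1) ^ j * q ^ (j choose 2) * (q ^ (j choose 2) * T) / qpoch a q j) *
       ((-1) ^ j * q ^ (j choose 2) * q powi (int j * (int x - int n + 1 - int i)) * qbinom q n j
        * qpoch (q ^ p) q (n - j)) =
     ((-1) ^ j * (-1) ^ j) * (q ^ (j choose 2) * q ^ (j choose 2) * q ^ (j choose 2)
      * q powi (int j * (int x - int n + 1 - int i))) * (T / qpoch a q j
        * qbinom q n j * qpoch (q ^ p) q (n - j))"
    by (simp only: divide_inverse mult_ac)
  then show ?thesis
    unfolding T assms(3)[symmetric] power_int_of_nat pw sg T_def by simp
qed

end

section \<open>Limits of the building blocks as \<open>q\<close> tends to 0\<close>

lemma tendsto_qpoch: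
  assumes "(c \<longlongrightarrow> c0) (at_right 0)"
  shows "((\<lambda>q. qpoch (c q) q k) \<longlongrightarrow> qpoch c0 0 k) (at_right 0)"
  unfolding qpoch_def by (intro tendsto_intros assms)

text \<open>Because \<open>0 ^ 0 = 1\<close>, the factor of index 0 is 1 - c; all later factors are
  1.\<close>

lemma qpoch_q_0: "qpoch c 0 k = (if k = 0 then 1 else 1 - c)"
  by (induction k) (auto simp: qpoch_Suc)

lemma tendsto_qpoch_const:
  "((\<lambda>q. qpoch c q k) \<longlongrightarrow> (if k = 0 then 1 else 1 - c)) (at_right 0)"
  using tendsto_qpoch[OF tendsto_const, of c k] by (simp only: qpoch_q_0)

lemma tendsto_qpoch_self: "((\<lambda>q. qpoch q q k) \<longlongrightarrow> 1) (at_right 0)"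
  using tendsto_qpoch[of "\<lambda>q. q" 0 k] by (simp add: qpoch_def)

lemma tendsto_qbinom:
  "((\<lambda>q. qbinom q n k) \<longlongrightarrow> (if k \<le> n then 1 else 0)) (at_right 0)"
proof (cases "k \<le> n")
  case True
  have "((\<lambda>q. qbinom q n k) \<longlongrightarrow> (\<Prod>i<k. (1 - 0 ^ (n - i)) / (1 - 0 ^ Suc i))) (at_right 0)"
    unfolding qbinom_def by (intro tendsto_intros) auto
  also have "(\<Prod>i<k. (1 - 0 ^ (n - i)) / (1 - 0 ^ Suc i)) = (1 :: real)"
    using True by (intro prod.neutral) auto
  finally show ?thesis using True by simp
qed (simp add: qbinom_eq_0)

lemma eventually_unit_interval: "eventually (\<lambda>q. 0 < q \<and> q < (1::real)) (at_right 0)"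
  by (auto simp: eventually_at_right_field intro!: exI[of _ 1])

section \<open>Limits of the q-Hahn polynomials\<close>

text \<open>With d = x - n + 1, the exponent (k choose 2) + kd vanishes only for k = 0, and for k =
  1 if d = 0. The case n = 1 is separate because a b q^(n-1) then does not tend to 0.\<close>

lemma q_Hahn_tendsto_from_diagonal:
  fixes a b :: real
  assumes "a < 1" "n \<le> N" "x \<le> N" "0 < n" "n - 1 \<le> x"
  shows "((\<lambda>q. q_Hahn a b N q n x) \<longlongrightarrow>
    (if x = n - 1 then 1 - (if n = 1 then 1 - a * b else 1) / (1 - a) else 1)) (at_right 0)"
proof -
  define d where "d = x - (n - 1)"
  define u :: real where "u = (if n = 1 then 1 - a * b else 1)"
  define f where "f k q = (-1) ^ k * q ^ ((k choose 2) + k * d) * qbinom q n k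
       * (qbinom q (N - x) k / qbinom q N k)
       * (qpoch (a * b * q ^ (n - 1)) q k / qpoch a q k)" for k and q :: real
  define L where "L k = (-1) ^ k * 0 ^ ((k choose 2) + k * d) * (if k \<le> n then 1 else 0)
       * ((if k \<le> N - x then 1 else 0) / (if k \<le> N then 1 else 0))
       * (qpoch (a * b * 0 ^ (n - 1)) 0 k / (if k = 0 then 1 else 1 - a))" for k
  have "(f k \<longlongrightarrow> L k) (at_right 0)" if "k \<le> n" for k
    unfolding f_def L_def
    using that assms by (intro tendsto_intros tendsto_qbinom tendsto_qpoch tendsto_qpoch_const) auto
  then have "((\<lambda>q. \<Sum>k\<le>n. f k q) \<longlongrightarrow> (\<Sum>k\<le>n. L k)) (at_right 0)"
    by (intro tendsto_sum) auto
  moreover have "eventually (\<lambda>q. q_Hahn a b N q n x = (\<Sum>k\<le>n. f k q)) (at_right 0)"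
    using eventually_unit_interval
  proof eventually_elim
    case (elim q)
    have "q powi (int k * (int x - int n + 1)) = q ^ (k * d)" for k
    proof -
      have "int k * (int x - int n + 1) = int (k * d)"
        using assms by (simp add: d_def of_nat_diff)
      then show ?thesis by (simp only: power_int_of_nat)
    qed
    moreover have "q powi (int n - 1) = q ^ (n - 1)"
      using assms by (simp add: power_int_def nat_diff_distrib)
    ultimately show ?case
      using elim assms(2,3) by (simp add: q_Hahn_eq f_def power_add mult_ac)
  qed
  ultimately have "((\<lambda>q. q_Hahn a b N q n x) \<longlongrightarrow> (\<Sum>k\<le>n. L k)) (at_right 0)"
    by (simp add: tendsto_cong)
  moreover have "(\<Sum>k\<le>n. L k) = (\<Sum>k\<in>{0, 1}. L k)"
  proof (rule sum.mono_neutral_right)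
    have "0 < k choose 2" if "2 \<le> k" for k using that by simp
    then show "\<forall>k\<in>{..n} - {0, 1}. L k = 0" by (auto simp: L_def not_less_eq_eq numeral_2_eq_2)
  qed (use assms in auto)
  moreover have "L 0 = 1" by (simp add: L_def)
  \<comment> \<open>If x = n - 1, then x < N, so [N-x,1] tends to 1 and the term survives.\<close>
  moreover have "L 1 = (if x = n - 1 then - u / (1 - a) else 0)"
    using assms by (auto simp: L_def d_def u_def qpoch_q_0 numeral_2_eq_2)
  ultimately show ?thesis by (auto simp: u_def split: if_splits)
qed

lemma q_Hahn_tendsto_below_diagonal:
  fixes a b :: real
  assumes "0 < a" "a < 1" "n \<le> N" "x \<le> N" "x < n - 1"
  shows "((\<lambda>q. q_Hahn a b N q n x) \<longlongrightarrow> 0) (at_right 0)"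
proof -
  \<comment> \<open>\<open>nat\<close> sends every nonpositive exponent to 0, so
    \<open>p i j = 0\<close> singles out exactly the terms that vanish identically.\<close>
  define p where "p i j = nat (int j + (int x - int n + 1 - int i))" for i j
  define g where "g i j q = (if p i j = 0 then 0 else
      ((-1) ^ i * q ^ (i choose 2) * qbinom q x i * q ^ (Suc (N - x) * i))
       * (q ^ ((j choose 2) + j * (p i j - 1)) * ((\<Prod>l<j. a * b * q ^ (n - 1 - l) - a) / qpoch a q j
        * qbinom q n j * qpoch (q ^ p i j) q (n - j))))" for i j and q :: real
  have g: "(g i j \<longlongrightarrow> 0) (at_right 0)" for i j
  proof (cases "p i j = 0")
    case False
    \<comment> \<open>A positive exponent means j > n - 1 - x + i, and n - 1 - x is at least
      1.\<close>
    then have "2 \<le> j" using assms by (auto simp: p_def)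
    then have E: "0 < (j choose 2) + j * (p i j - 1)" by simp
    have "((\<lambda>q::real. q ^ ((j choose 2) + j * (p i j - 1)))
        \<longlongrightarrow> 0 ^ ((j choose 2) + j * (p i j - 1))) (at_right 0)"
      by (intro tendsto_intros)
    then have pow: "((\<lambda>q::real. q ^ ((j choose 2) + j * (p i j - 1))) \<longlongrightarrow> 0) (at_right 0)"
      using E by (simp only: zero_power)
    have "(g i j \<longlongrightarrow>
      ((-1) ^ i * 0 ^ (i choose 2) * (if i \<le> x then 1 else 0) * 0 ^ (Suc (N - x) * i))
       * (0 * ((\<Prod>l<j. a * b * 0 ^ (n - 1 - l) - a) / (if j = 0 then 1 else 1 - a)
        * (if j \<le> n then 1 else 0) * qpoch (0 ^ p i j) 0 (n - j)))) (at_right 0)"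
      unfolding g_def if_not_P[OF False] using assms
      by (intro tendsto_intros pow tendsto_qbinom tendsto_qpoch tendsto_qpoch_const) auto
    then show ?thesis by simp
  next
    case True
    then have "g i j = (\<lambda>q. 0)" by (simp add: g_def fun_eq_iff)
    then show ?thesis by simp
  qed
  have "((\<lambda>q. qpoch q q (N - x) / qpoch q q N * (\<Sum>i\<le>x. \<Sum>j\<le>n. g i j q))
      \<longlongrightarrow> 1 / 1 * (\<Sum>i\<le>x. \<Sum>j\<le>n. 0)) (at_right 0)"
    by (intro tendsto_intros tendsto_qpoch_self g) auto
  moreover have "eventually (\<lambda>q. q_Hahn a b N q n x
      = qpoch q q (N - x) / qpoch q q N * (\<Sum>i\<le>x. \<Sum>j\<le>n. g i j q)) (at_right 0)"
    using eventually_unit_interval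
  proof eventually_elim
    case (elim q)
    show ?case
      unfolding q_Hahn_double_sum[OF elim[THEN conjunct1] elim[THEN conjunct2] assms(1-4)]
    proof (rule arg_cong[where f = "(*) (qpoch q q (N - x) / qpoch q q N)"], intro sum.cong refl)
      fix i j assume ij: "i \<in> {..x}" "j \<in> {..n}"
      let ?m = "int x - int n + 1 - int i"
      show "((-1) ^ i * q ^ (i choose 2) * qbinom q x i * q ^ (Suc (N - x) * i)) *
       ((-1) ^ j * q ^ (j choose 2) * (\<Prod>l<j. a * b * q powi (int n - 1) - a * q ^ l) / qpoch a q j) *
       ((-1) ^ j * q ^ (j choose 2) * q powi (int j * ?m) * qbinom q n j
        * qpoch (q powi (int j + ?m)) q (n - j)) = g i j q"
      proof (cases "p i j = 0")
        case True
        \<comment> \<open>The factor 1 - q^0 has index n - 1 - x - j + i, which is less than n - j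
          because i is at most x.\<close>
        then have "qpoch (q powi (int j + ?m)) q (n - j) = 0"
          using elim ij assms by (intro qpoch_qpowi_eq_0) (auto simp: p_def)
        then show ?thesis using True by (simp add: g_def)
      next
        case False
        then have "int (p i j) = int j + ?m" by (simp add: p_def)
        then show ?thesis
          unfolding g_def if_not_P[OF False] mult.assoc[of "(-1) ^ i * _ * _ * _"]
          using elim ij False by (intro arg_cong2[where f = times] refl double_sum_term) auto
      qed
    qed
  qed
  ultimately show ?thesis by (simp add: tendsto_cong)
qed

theorem theorem4p3:
  fixes a b :: real and N n x :: nat
  assumes "0 < a" and "a < 1" and "b < 1" and "N > 0"
    and "n \<le> N" and "x \<le> N"
  shows "((\<lambda>q. q_Hahn a b N q n x) \<longlongrightarrow> little_0_Jacobi a b n x) (at_right 0)"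
proof -
  \<comment> \<open>By truncated subtraction the third case forces n to be at least 2.\<close>
  consider "n = 0" | "0 < n" "n - 1 \<le> x" | "x < n - 1" by linarith
  then show ?thesis
  proof cases
    case 1
    then show ?thesis by (simp add: q_Hahn_def little_0_Jacobi_def)
  next
    case 2
    \<comment> \<open>At x = n - 1 the two shapes agree: 1 - (1 - ab)/(1 - a) = -a(1 - b)/(1 - a)
      for n = 1, and 1 - 1/(1 - a) = -a/(1 - a) for larger n.\<close>
    then have "little_0_Jacobi a b n x =
        (if x = n - 1 then 1 - (if n = 1 then 1 - a * b else 1) / (1 - a) else 1)"
      using assms by (auto simp: little_0_Jacobi_def field_simps)
    then show ?thesis using q_Hahn_tendsto_from_diagonal 2 assms by simp
  next
    case 3
    then have "little_0_Jacobi a b n x = 0" by (auto simp: little_0_Jacobi_def)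
    then show ?thesis
      using q_Hahn_tendsto_below_diagonal 3 assms by simp
  qed
qed

end
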